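(* Any 3-element subset $X$ of the octatonic set $O_{01}=\{0,1,3,4,6,7,9,10\}\subset\mathbb{Z}_{12}$ generates a simply transitive cover of $O_{01}$ with respect to the set-wise stabilizer $G_0=\{T_0,T_3,T_6,T_9,I_7,I_{10},I_1,I_4\}$ of $O_{01}$ in the mod $12$ $T/I$-group. That is, the union of the sets in the orbit $G_0X=\{gX:g\in G_0\}$ is $O_{01}$, and $G_0$ acts simply transitively on $G_0X$.
   Context: The mod 12 $T/I$-group consists of the transpositions $T_i(x)=x+i$ and inversions $I_i(x)=-x+i$ of $\mathbb{Z}_{12}$, $i\in\mathbb{Z}_{12}$. It acts on unordered subsets of $\mathbb{Z}_{12}$ by $gX=\{g(x):x\in X\}$. An action of a group $G$ on a set $S$ is simply transitive if each pair $s,t\in S$ admits a unique $g\in G$ with $gs=t$. *)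

theory Defs
  imports "HOL-Algebra.Group_Action" "HOL-Library.Numeral_Type"
begin

text \<open>
  The type \<^typ>\<open>12\<close> is the ring of integers modulo 12: it has exactly 12 elements and its
  arithmetic, including that of numerals, is taken modulo 12.
\<close>

type_synonym Z12 = 12

definition transposition :: "Z12 \<Rightarrow> Z12 \<Rightarrow> Z12" ("\<T>")
  where "\<T> i = (\<lambda>x. x + i)"

definition inversion :: "Z12 \<Rightarrow> Z12 \<Rightarrow> Z12" ("\<I>")
  where "\<I> i = (\<lambda>x. - x + i)"

definition TI_group :: "(Z12 \<Rightarrow> Z12) monoid"
  where "TI_group = \<lparr>carrier = range \<T> \<union> range \<I>, mult = (\<circ>), one = id\<rparr>"

definition set_act :: "(Z12 \<Rightarrow> Z12) \<Rightarrow> Z12 set \<Rightarrow> Z12 set"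
  where "set_act g X = g ` X"

definition octatonic :: "Z12 set" ("O\<^sub>0\<^sub>1")
  where "O\<^sub>0\<^sub>1 = {0, 1, 3, 4, 6, 7, 9, 10}"

definition octatonic_group :: "(Z12 \<Rightarrow> Z12) monoid" ("G\<^sub>0")
  where "G\<^sub>0 = TI_group\<lparr>carrier := stabilizer TI_group set_act O\<^sub>0\<^sub>1\<rparr>"

locale simply_transitive_action = group_action +
  assumes simply_transitive:
    "\<lbrakk>s \<in> E; t \<in> E\<rbrakk> \<Longrightarrow> \<exists>!g. g \<in> carrier G \<and> \<phi> g s = t"

text \<open>
  The restriction to the orbit is there because \<^const>\<open>group_action\<close> requires the maps
  \<open>\<phi> g\<close> to be extensional on the set acted upon.
\<close>

definition generates_simply_transitive_cover ::
    "('g, 'm) monoid_scheme \<Rightarrow> ('g \<Rightarrow> 'a set \<Rightarrow> 'a set) \<Rightarrow> 'a set \<Rightarrow> 'a set \<Rightarrow> bool"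
  where "generates_simply_transitive_cover G \<phi> X S \<longleftrightarrow>
    \<Union>(orbit G \<phi> X) = S \<and>
    simply_transitive_action G (orbit G \<phi> X) (\<lambda>g. restrict (\<phi> g) (orbit G \<phi> X))"

end

theory Submission
  imports Defs
begin

text \<open>
  An element of \<open>G\<^sub>0\<close> fixing a trichord \<open>X\<close> set-wise is trivial: every involution of \<open>G\<^sub>0\<close> is free
  of fixed points on the octatonic set, whereas an involution of a set of odd size fixes a point;
  the remaining elements \<open>\<T> 3\<close> and \<open>\<T> 9\<close> square to the involution \<open>\<T> 6\<close>. Simple transitivity on
  the orbit follows, and the orbit covers because \<open>G\<^sub>0\<close> is transitive on the octatonic set.
\<close>

text \<open>Turns the pointwise axioms of an action into a homomorphism to
  \<open>BijGroup E\<close>. Each map is a bijection because \<open>inv g\<close> acts as its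
  two-sided inverse.\<close>

lemma group_actionI:
  fixes G (structure)
  assumes "group G"
    and closed: "\<And>g x. \<lbrakk>g \<in> carrier G; x \<in> E\<rbrakk> \<Longrightarrow> \<phi> g x \<in> E"
    and one: "\<And>x. x \<in> E \<Longrightarrow> \<phi> \<one> x = x"
    and mult: "\<And>g h x. \<lbrakk>g \<in> carrier G; h \<in> carrier G; x \<in> E\<rbrakk> \<Longrightarrow> \<phi> (g \<otimes> h) x = \<phi> g (\<phi> h x)"
  shows "group_action G E (\<lambda>g. restrict (\<phi> g) E)"
proof -
  interpret group G by fact
  have bij: "restrict (\<phi> g) E \<in> Bij E" if g: "g \<in> carrier G" for g
  proof -
    have "bij_betw (\<phi> g) E E"
    proof (rule bij_betwI[where g = "\<phi> (inv g)"])
      show "\<phi> (inv g) (\<phi> g x) = x" if "x \<in> E" for x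
        using g that mult[of "inv g" g x] by (simp add: one)
      show "\<phi> g (\<phi> (inv g) x) = x" if "x \<in> E" for x
        using g that mult[of g "inv g" x] by (simp add: one)
    qed (use g closed in auto)
    then show ?thesis
      by (simp add: Bij_def)
  qed
  have "restrict (\<phi> (g \<otimes> h)) E = compose E (restrict (\<phi> g) E) (restrict (\<phi> h) E)"
    if "g \<in> carrier G" "h \<in> carrier G" for g h
    using that closed mult by (auto simp: compose_def fun_eq_iff)
  then have "(\<lambda>g. restrict (\<phi> g) E) \<in> hom G (BijGroup E)"
    by (intro homI) (auto simp: BijGroup_def bij)
  then show ?thesis
    by (intro group_action.intro group_hom.intro group_hom_axioms.intro group_BijGroup is_group)
qed

text \<open>If \<open>a\<close> and \<open>b\<close> carry \<open>x\<close> to \<open>s\<close> and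
  \<open>t\<close>, then \<open>b \<otimes> inv a\<close> carries \<open>s\<close> to
  \<open>t\<close>. For any \<open>g\<close> that does so,
  \<open>inv b \<otimes> (g \<otimes> a)\<close> fixes \<open>x\<close> and hence is
  \<open>\<one>\<close>.\<close>

lemma simply_transitive_action_orbit:
  fixes G (structure)
  assumes "group G"
    and one: "\<And>y. \<phi> \<one> y = y"
    and mult: "\<And>g h y. \<lbrakk>g \<in> carrier G; h \<in> carrier G\<rbrakk> \<Longrightarrow> \<phi> (g \<otimes> h) y = \<phi> g (\<phi> h y)"
    and stab: "stabilizer G \<phi> x \<subseteq> {\<one>}"
  shows "simply_transitive_action G (orbit G \<phi> x) (\<lambda>g. restrict (\<phi> g) (orbit G \<phi> x))"
proof -
  interpret group G by fact
  interpret group_action G "orbit G \<phi> x" "\<lambda>g. restrict (\<phi> g) (orbit G \<phi> x)"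
  proof (rule group_actionI)
    show "\<phi> g y \<in> orbit G \<phi> x" if "g \<in> carrier G" "y \<in> orbit G \<phi> x" for g y
      using that by (auto simp: orbit_def simp flip: mult)
  qed (use assms in auto)
  show ?thesis
  proof
    fix s t assume s: "s \<in> orbit G \<phi> x" and t: "t \<in> orbit G \<phi> x"
    then obtain a b where a: "a \<in> carrier G" "s = \<phi> a x" and b: "b \<in> carrier G" "t = \<phi> b x"
      by (auto simp: orbit_def)
    have "\<phi> (b \<otimes> inv a) s = t"
      using a b by (simp add: m_assoc flip: mult)
    moreover have "g = b \<otimes> inv a" if g: "g \<in> carrier G" "\<phi> g s = t" for g
    proof -
      have "\<phi> (inv b \<otimes> (g \<otimes> a)) x = \<phi> (inv b) (\<phi> b x)"
        using a b g by (simp add: mult)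
      also have "\<dots> = x"
        using b one by (simp flip: mult)
      finally have "inv b \<otimes> (g \<otimes> a) \<in> stabilizer G \<phi> x"
        using a b g by (simp add: stabilizer_def)
      then have "inv b \<otimes> (g \<otimes> a) = \<one>"
        using stab by blast
      then have "g \<otimes> a = b"
        using a b g by (metis inv_closed inv_equality inv_inv m_closed)
      then show ?thesis
        using a b g by (metis inv_solve_right)
    qed
    ultimately show "\<exists>!g. g \<in> carrier G \<and> restrict (\<phi> g) (orbit G \<phi> x) s = t"
      using a b s by (intro ex1I[of _ "b \<otimes> inv a"]) auto
  qed
qed

lemma fixpoint_of_involution:
  assumes "card X = 3" and "h ` X = X" and "\<And>x. x \<in> X \<Longrightarrow> h (h x) = x"
  obtains x where "x \<in> X" and "h x = x"
proof -
  obtain a b c where "X = {a, b, c}" and "a \<noteq> b" "a \<noteq> c" "b \<noteq> c"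
    using assms(1) by (auto simp: card_3_iff)
  then show ?thesis
    \<comment> \<open>A point that is not fixed is swapped with another one; the third point must
      then go to itself, as both other values are taken.\<close>
    using that assms(2,3) by (metis image_eqI insert_iff singletonD)
qed

text \<open>Allows a claim about every residue to be settled by twelve evaluations.\<close>

lemma UNIV_Z12: "(UNIV :: Z12 set) = {0, 1, 2, 3, 4, 5, 6, 7, 8, 9, 10, 11}"
proof -
  have "x \<in> {0, 1, 2, 3, 4, 5, 6, 7, 8, 9, 10, 11}" for x :: Z12
  proof (cases x)
    case (of_int z)
    then have "0 \<le> z" "z < 12" by simp_all
    then have "z \<in> {0, 1, 2, 3, 4, 5, 6, 7, 8, 9, 10, 11}"
      unfolding insert_iff empty_iff by presburger
    then show ?thesis
      using of_int by auto
  qed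
  then show ?thesis by blast
qed

lemma group_TI_group: "group TI_group"
proof (rule groupI)
  \<comment> \<open>The identity is \<open>\<T> 0\<close>, whence the witness 0.\<close>
  show "\<one>\<^bsub>TI_group\<^esub> \<in> carrier TI_group"
    by (auto simp: TI_group_def transposition_def fun_eq_iff intro!: image_eqI[of _ _ 0])
  show "f \<otimes>\<^bsub>TI_group\<^esub> g \<in> carrier TI_group"
    if "f \<in> carrier TI_group" "g \<in> carrier TI_group" for f g
  proof -
    have "\<T> i \<circ> \<T> j = \<T> (i + j)" "\<T> i \<circ> \<I> j = \<I> (i + j)"
      "\<I> i \<circ> \<T> j = \<I> (i - j)" "\<I> i \<circ> \<I> j = \<T> (i - j)" for i j
      by (auto simp: transposition_def inversion_def)
    then show ?thesis
      using that by (auto simp: TI_group_def)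
  qed
  show "\<exists>g\<in>carrier TI_group. g \<otimes>\<^bsub>TI_group\<^esub> f = \<one>\<^bsub>TI_group\<^esub>" if "f \<in> carrier TI_group" for f
  proof -
    have "\<T> (- i) \<circ> \<T> i = id" "\<I> i \<circ> \<I> i = id" for i
      by (auto simp: transposition_def inversion_def)
    then show ?thesis
      using that by (auto simp: TI_group_def)
  qed
qed (auto simp: TI_group_def)

lemma carrier_octatonic_group:
  "carrier G\<^sub>0 = {\<T> 0, \<T> 3, \<T> 6, \<T> 9, \<I> 7, \<I> 10, \<I> 1, \<I> 4}"
proof -
  \<comment> \<open>Decided by exhaustion over the index: \<open>set_eq_subset\<close> reduces the
    equality of two explicit sets to membership tests between numerals.\<close>
  have T: "\<T> i ` O\<^sub>0\<^sub>1 = O\<^sub>0\<^sub>1 \<longleftrightarrow> i \<in> {0, 3, 6, 9}" for i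
  proof -
    have "i \<in> {0, 1, 2, 3, 4, 5, 6, 7, 8, 9, 10, 11}"
      using UNIV_Z12 by blast
    then show ?thesis
      by (elim insertE emptyE) (simp_all add: octatonic_def transposition_def set_eq_subset)
  qed
  have I: "\<I> i ` O\<^sub>0\<^sub>1 = O\<^sub>0\<^sub>1 \<longleftrightarrow> i \<in> {7, 10, 1, 4}" for i
  proof -
    have "i \<in> {0, 1, 2, 3, 4, 5, 6, 7, 8, 9, 10, 11}"
      using UNIV_Z12 by blast
    then show ?thesis
      by (elim insertE emptyE) (simp_all add: octatonic_def inversion_def set_eq_subset)
  qed
  have "carrier G\<^sub>0 = \<T> ` {i. \<T> i ` O\<^sub>0\<^sub>1 = O\<^sub>0\<^sub>1} \<union> \<I> ` {i. \<I> i ` O\<^sub>0\<^sub>1 = O\<^sub>0\<^sub>1}"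
    by (auto simp: octatonic_group_def stabilizer_def TI_group_def set_act_def)
  then show ?thesis
    by (simp add: T I insert_commute Collect_disj_eq)
qed

lemma group_octatonic_group: "group G\<^sub>0"
proof -
  \<comment> \<open>The action on all sets of residues makes \<open>stabilizer_subgroup\<close>
    applicable; restricting to \<open>UNIV\<close> changes nothing.\<close>
  interpret TI: group_action TI_group UNIV "\<lambda>g. restrict (set_act g) UNIV"
    by (rule group_actionI)
       (auto simp: group_TI_group, auto simp: TI_group_def set_act_def)
  show ?thesis
    using group.subgroup_imp_group[OF group_TI_group TI.stabilizer_subgroup[of O\<^sub>0\<^sub>1]]
    by (simp add: octatonic_group_def stabilizer_def)
qed

lemma octatonic_group_transitive:
  assumes "x \<in> O\<^sub>0\<^sub>1" and "y \<in> O\<^sub>0\<^sub>1"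
  shows "\<exists>g\<in>carrier G\<^sub>0. g x = y"
proof -
  \<comment> \<open>The octatonic set consists of the residues 0 and 1 modulo 3. Points of the same
    class differ by a multiple of 3; points of different classes have a sum congruent to 1 modulo
    3.\<close>
  have "y - x \<in> {0, 3, 6, 9} \<or> y + x \<in> {7, 10, 1, 4}"
    using assms by (auto simp: octatonic_def)
  then have "\<T> (y - x) \<in> carrier G\<^sub>0 \<or> \<I> (y + x) \<in> carrier G\<^sub>0"
    by (auto simp: carrier_octatonic_group)
  moreover have "\<T> (y - x) x = y" "\<I> (y + x) x = y"
    by (simp_all add: transposition_def inversion_def)
  ultimately show ?thesis
    by blast
qed

lemma Union_orbit_octatonic:
  assumes "X \<subseteq> O\<^sub>0\<^sub>1" and "X \<noteq> {}"
  shows "\<Union>(orbit G\<^sub>0 set_act X) = O\<^sub>0\<^sub>1"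
proof
  have "g ` O\<^sub>0\<^sub>1 = O\<^sub>0\<^sub>1" if "g \<in> carrier G\<^sub>0" for g
    using that by (simp add: octatonic_group_def stabilizer_def set_act_def)
  then show "\<Union>(orbit G\<^sub>0 set_act X) \<subseteq> O\<^sub>0\<^sub>1"
    using assms(1) by (fastforce simp: orbit_def set_act_def)
  \<comment> \<open>A single point of \<open>X\<close> is enough, since its images already exhaust
    the octatonic set.\<close>
  obtain x where "x \<in> X"
    using assms(2) by blast
  then show "O\<^sub>0\<^sub>1 \<subseteq> \<Union>(orbit G\<^sub>0 set_act X)"
    using assms(1) octatonic_group_transitive[of x]
    by (fastforce simp: orbit_def set_act_def)
qed

lemma stabilizer_octatonic_trichord:
  assumes "X \<subseteq> O\<^sub>0\<^sub>1" and "card X = 3"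
  shows "stabilizer G\<^sub>0 set_act X \<subseteq> {id}"
proof
  fix g assume "g \<in> stabilizer G\<^sub>0 set_act X"
  then have g: "g \<in> {\<T> 0, \<T> 3, \<T> 6, \<T> 9, \<I> 7, \<I> 10, \<I> 1, \<I> 4}" and gX: "g ` X = X"
    by (simp_all add: stabilizer_def carrier_octatonic_group set_act_def)
  \<comment> \<open>The square of \<open>g\<close> is needed for \<open>\<T> 3\<close> and
    \<open>\<T> 9\<close>: both square to \<open>\<T> 6\<close>, as 9 + 9 = 6 modulo 12.\<close>
  have ggX: "(g \<circ> g) ` X = X"
    using gX by (metis image_comp)
  have no_T6: "\<T> 6 ` X \<noteq> X"
    by (rule notI, erule fixpoint_of_involution[OF assms(2)]) (simp_all add: transposition_def)
  have no_I: "\<I> i ` X \<noteq> X" if "i \<in> {7, 10, 1, 4}" for i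
  proof
    assume "\<I> i ` X = X"
    then obtain x where "x \<in> X" "\<I> i x = x"
      by (rule fixpoint_of_involution[OF assms(2)]) (simp add: inversion_def)
    \<comment> \<open>A fixed point satisfies 2x = i. This has no solution for i = 1 and i = 7; for
      i = 4 it gives 2 or 8, for i = 10 it gives 5 or 11, all outside the octatonic set.\<close>
    then show False
      using that assms(1) by (auto simp: inversion_def octatonic_def)
  qed
  have "\<T> 3 \<circ> \<T> 3 = \<T> 6" "\<T> 9 \<circ> \<T> 9 = \<T> 6"
    by (auto simp: transposition_def fun_eq_iff)
  then have "g \<noteq> \<T> 3" "g \<noteq> \<T> 9"
    using ggX no_T6 by metis+
  then have "g = \<T> 0"
    using g gX no_T6 no_I by blast
  then show "g \<in> {id}"
    by (simp add: transposition_def fun_eq_iff)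
qed

theorem corollary6p2:
  fixes X :: "Z12 set"
  assumes "X \<subseteq> O\<^sub>0\<^sub>1" and "card X = 3"
  shows "carrier G\<^sub>0 = {\<T> 0, \<T> 3, \<T> 6, \<T> 9, \<I> 7, \<I> 10, \<I> 1, \<I> 4} \<and>
    generates_simply_transitive_cover G\<^sub>0 set_act X O\<^sub>0\<^sub>1"
proof -
  \<comment> \<open>Shrinking the carrier keeps \<open>id\<close> and \<open>\<circ>\<close>, so the
    action axioms become the usual laws for images.\<close>
  have [simp]: "\<one>\<^bsub>G\<^sub>0\<^esub> = id" "g \<otimes>\<^bsub>G\<^sub>0\<^esub> h = g \<circ> h" for g h
    by (simp_all add: octatonic_group_def TI_group_def)
  have "simply_transitive_action G\<^sub>0 (orbit G\<^sub>0 set_act X)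
      (\<lambda>g. restrict (set_act g) (orbit G\<^sub>0 set_act X))"
    by (rule simply_transitive_action_orbit[OF group_octatonic_group])
       (use stabilizer_octatonic_trichord[OF assms] in \<open>simp_all add: set_act_def image_comp\<close>)
  moreover have "X \<noteq> {}"
    using assms(2) by auto
  ultimately show ?thesis
    using carrier_octatonic_group Union_orbit_octatonic[OF assms(1)]
    by (simp add: generates_simply_transitive_cover_def)
qed

end
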